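(* Let $s_1,\dots,s_n\in\mathcal{S}$ be given, with solutions $x_j(t)=x(t,s_j)$ of the parameterized dynamical system $x'=f(x,t,s)$, $x(0)=x_0$, and fix $s\in\mathcal{S}$. Let $a_k\in\mathbb{R}^n$ satisfy $e^Ta_k=1$, let $\mathcal{J}_k=\mathcal{J}(a_k)$ and $$R_k=\mathcal{J}_k+\bigl(h(a_k)-\mathcal{J}_ka_k\bigr)e^T\in\mathbb{R}^{mp\times n},$$ and let $a_{k+1}$ be the Newton iterate, i.e. a solution of the constrained least squares problem $$\text{minimize}_{a\in\mathbb{R}^n}\ \|R_ka\|\quad\text{subject to}\quad e^Ta=1.$$ Let $\sigma_{\min}(R_k)$ be the minimum singular value of $R_k$. Then $$\sigma_{\min}(R_k)\;\leq\;\sqrt{n}\left(\|\mathcal{J}_k\|\,\|a_{k+1}-a_k\|+\sqrt{\rho(a_k)}\right).$$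
   Context: Setting. $\mathcal{S}\subset\mathbb{R}^d$ is the parameter space, $T>0$, and for each $s\in\mathcal{S}$, $x(t,s)\in\mathbb{R}^p$ is the solution on $[0,T]$ of $x'=f(x,t,s)$ with initial condition $x(0)=x_0$ independent of $s$. The solution is assumed bounded over $t\in[0,T]$, $s\in\mathcal{S}$; $f$ is $\mathbb{R}^p$-valued, Lipschitz continuous, differentiable in $x$, and its Jacobian $\nabla_x f$ is nonsingular. Fix times $0\le t_1<\cdots<t_m\le T$ and integration weights $w_i^2$ ($w_i>0$). $e\in\mathbb{R}^n$ is the vector of ones; $\|\cdot\|$ is the Euclidean norm on vectors and the induced operator norm on matrices. $X_i\in\mathbb{R}^{p\times n}$ has $j$th column $x_j(t_i)$. $F\in\mathbb{R}^{mp\times n}$ is the vertical stack of the blocks $w_iF_i$, where $F_i\in\mathbb{R}^{p\times n}$ has $j$th column $f(x_j(t_i),t_i,s_j)$. For $a\in\mathbb{R}^n$, $\varphi(a)\in\mathbb{R}^{mp}$ is the vertical stack of the blocks $w_if(X_ia,t_i,s)$, $h(a)=Fa-\varphi(a)$, $\rho(a)=\|h(a)\|^2$, and $\mathcal{J}(a)\in\mathbb{R}^{mp\times n}$ is the Jacobian of $h$ with respect to $a$. The least squares problems are overdetermined ($mp\ge n$), and $\sigma_{\min}(R)$ denotes the smallest of the $n$ singular values of $R\in\mathbb{R}^{mp\times n}$, i.e. $\min_{\|v\|=1}\|Rv\|$. *)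

theory Defs
  imports "HOL-Analysis.Analysis"
begin

text \<open>
  Vectors in \<open>\<real>\<^sup>m\<^sup>p\<close> are indexed by pairs (time index, state component): the type
  \<open>real ^ ('m \<times> 'p)\<close> carries the Euclidean norm on all \<open>m \<cdot> p\<close> entries.
\<close>

definition snapshots ::
    "(real \<Rightarrow> real^'d \<Rightarrow> real^'p) \<Rightarrow> ('n::finite \<Rightarrow> real^'d) \<Rightarrow> real \<Rightarrow> real^'n^'p" where
  "snapshots x \<sigma> t = (\<chi> l j. x t (\<sigma> j) $ l)"

definition forcing ::
    "(real^'p \<Rightarrow> real \<Rightarrow> real^'d \<Rightarrow> real^'p) \<Rightarrow> (real \<Rightarrow> real^'d \<Rightarrow> real^'p) \<Rightarrow>
     ('n::finite \<Rightarrow> real^'d) \<Rightarrow> real \<Rightarrow> real^'n^'p" where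
  "forcing f x \<sigma> t = (\<chi> l j. f (x t (\<sigma> j)) t (\<sigma> j) $ l)"

definition forcing_stack ::
    "(real^'p \<Rightarrow> real \<Rightarrow> real^'d \<Rightarrow> real^'p) \<Rightarrow> (real \<Rightarrow> real^'d \<Rightarrow> real^'p) \<Rightarrow>
     ('n::finite \<Rightarrow> real^'d) \<Rightarrow> ('m::finite \<Rightarrow> real) \<Rightarrow> ('m \<Rightarrow> real) \<Rightarrow> real^'n^('m \<times> 'p)" where
  "forcing_stack f x \<sigma> \<tau> w = (\<chi> r j. w (fst r) * forcing f x \<sigma> (\<tau> (fst r)) $ snd r $ j)"

definition phi ::
    "(real^'p \<Rightarrow> real \<Rightarrow> real^'d \<Rightarrow> real^'p) \<Rightarrow> (real \<Rightarrow> real^'d \<Rightarrow> real^'p) \<Rightarrow>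
     ('n::finite \<Rightarrow> real^'d) \<Rightarrow> ('m::finite \<Rightarrow> real) \<Rightarrow> ('m \<Rightarrow> real) \<Rightarrow> real^'d \<Rightarrow>
     real^'n \<Rightarrow> real^('m \<times> 'p)" where
  "phi f x \<sigma> \<tau> w s a =
     (\<chi> r. w (fst r) * f (snapshots x \<sigma> (\<tau> (fst r)) *v a) (\<tau> (fst r)) s $ snd r)"

definition h_res ::
    "(real^'p \<Rightarrow> real \<Rightarrow> real^'d \<Rightarrow> real^'p) \<Rightarrow> (real \<Rightarrow> real^'d \<Rightarrow> real^'p) \<Rightarrow>
     ('n::finite \<Rightarrow> real^'d) \<Rightarrow> ('m::finite \<Rightarrow> real) \<Rightarrow> ('m \<Rightarrow> real) \<Rightarrow> real^'d \<Rightarrow>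
     real^'n \<Rightarrow> real^('m \<times> 'p)" where
  "h_res f x \<sigma> \<tau> w s a = forcing_stack f x \<sigma> \<tau> w *v a - phi f x \<sigma> \<tau> w s a"

definition rho ::
    "(real^'p \<Rightarrow> real \<Rightarrow> real^'d \<Rightarrow> real^'p) \<Rightarrow> (real \<Rightarrow> real^'d \<Rightarrow> real^'p) \<Rightarrow>
     ('n::finite \<Rightarrow> real^'d) \<Rightarrow> ('m::finite \<Rightarrow> real) \<Rightarrow> ('m \<Rightarrow> real) \<Rightarrow> real^'d \<Rightarrow>
     real^'n \<Rightarrow> real" where
  "rho f x \<sigma> \<tau> w s a = (norm (h_res f x \<sigma> \<tau> w s a))\<^sup>2"

definition Jac ::
    "(real^'p \<Rightarrow> real \<Rightarrow> real^'d \<Rightarrow> real^'p) \<Rightarrow> (real \<Rightarrow> real^'d \<Rightarrow> real^'p) \<Rightarrow>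
     ('n::finite \<Rightarrow> real^'d) \<Rightarrow> ('m::finite \<Rightarrow> real) \<Rightarrow> ('m \<Rightarrow> real) \<Rightarrow> real^'d \<Rightarrow>
     real^'n \<Rightarrow> real^'n^('m \<times> 'p)" where
  "Jac f x \<sigma> \<tau> w s a = jacobian (h_res f x \<sigma> \<tau> w s) (at a)"

text \<open>The vector \<open>e\<close> of ones is \<open>1 :: real^'n\<close>, so \<open>rowvector 1\<close> below is \<open>e\<^sup>T\<close>.\<close>

definition R_mat ::
    "(real^'p \<Rightarrow> real \<Rightarrow> real^'d \<Rightarrow> real^'p) \<Rightarrow> (real \<Rightarrow> real^'d \<Rightarrow> real^'p) \<Rightarrow>
     ('n::finite \<Rightarrow> real^'d) \<Rightarrow> ('m::finite \<Rightarrow> real) \<Rightarrow> ('m \<Rightarrow> real) \<Rightarrow> real^'d \<Rightarrow>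
     real^'n \<Rightarrow> real^'n^('m \<times> 'p)" where
  "R_mat f x \<sigma> \<tau> w s a =
     Jac f x \<sigma> \<tau> w s a +
     (columnvector (h_res f x \<sigma> \<tau> w s a - Jac f x \<sigma> \<tau> w s a *v a) :: real^1^('m \<times> 'p)) **
     (rowvector 1 :: real^'n^1)"

text \<open>
  The \<open>n\<close> singular values of a matrix with \<open>n\<close> columns (and at least \<open>n\<close> rows), as a set: the
  square roots of the eigenvalues of \<open>A\<^sup>T A\<close>.
\<close>

definition singular_values :: "real^'n^'m \<Rightarrow> real set" where
  "singular_values A =
     {sqrt \<mu> | \<mu>. \<exists>v. v \<noteq> 0 \<and> (transpose A ** A) *v v = \<mu> *\<^sub>R v}"

definition sigma_min :: "real^'n^'m \<Rightarrow> real" where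
  "sigma_min A = Min (singular_values A)"

definition opnorm :: "real^'n^'m \<Rightarrow> real" where
  "opnorm A = onorm ((*v) A)"

lemma gram_inner:
  fixes A :: "real^'n^'m"
  shows "((transpose A ** A) *v x) \<bullet> y = (A *v x) \<bullet> (A *v y)"
proof -
  have "(A *v x) \<bullet> (A *v y) = ((A *v x) v* A) \<bullet> y"
    by (simp add: dot_lmul_matrix)
  also have "(A *v x) v* A = transpose A *v (A *v x)" by simp
  finally show ?thesis by (simp add: matrix_vector_mul_assoc)
qed

lemma finite_singular_values:
  fixes A :: "real^'n^'m"
  shows "finite (singular_values A)"
proof -
  let ?M = "transpose A ** A"
  define E where "E = {\<mu>. \<exists>v. v \<noteq> 0 \<and> ?M *v v = \<mu> *\<^sub>R v}"
  have "\<forall>\<mu>\<in>E. \<exists>v. v \<noteq> 0 \<and> ?M *v v = \<mu> *\<^sub>R v" unfolding E_def by blast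
  then obtain g where g: "\<And>\<mu>. \<mu> \<in> E \<Longrightarrow> g \<mu> \<noteq> 0 \<and> ?M *v g \<mu> = \<mu> *\<^sub>R g \<mu>" by metis
  have orth: "g \<mu> \<bullet> g \<nu> = 0" if "\<mu> \<in> E" "\<nu> \<in> E" "\<mu> \<noteq> \<nu>" for \<mu> \<nu>
  proof -
    have "(?M *v g \<mu>) \<bullet> g \<nu> = (?M *v g \<nu>) \<bullet> g \<mu>"
      by (metis gram_inner inner_commute)
    then have "\<mu> * (g \<mu> \<bullet> g \<nu>) = \<nu> * (g \<mu> \<bullet> g \<nu>)"
      using g that by (simp add: inner_commute)
    then show ?thesis using that by simp
  qed
  have inj: "inj_on g E"
    by (rule inj_onI) (metis orth g inner_eq_zero_iff)
  have "pairwise orthogonal (g ` E)"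
    unfolding pairwise_def orthogonal_def using orth by fastforce
  moreover have "0 \<notin> g ` E" using g by force
  ultimately have "finite (g ` E)"
    using pairwise_orthogonal_independent independent_bound by blast
  then have "finite E" using inj finite_image_iff by blast
  moreover have "singular_values A = sqrt ` E" unfolding singular_values_def E_def by blast
  ultimately show ?thesis by simp
qed

text \<open>The variational characterization \<open>\<sigma>\<^sub>m\<^sub>i\<^sub>n(A) = min {\<parallel>A v\<parallel> | \<parallel>v\<parallel> = 1}\<close>, with the minimum attained.\<close>

lemma sigma_min_variational:
  fixes A :: "real^'n^'m"
  shows "\<exists>v. norm v = 1 \<and> sigma_min A = norm (A *v v)"
    and "norm v = 1 \<Longrightarrow> sigma_min A \<le> norm (A *v v)"
proof -
  let ?M = "transpose A ** A"
  have "\<exists>v\<in>sphere 0 1. \<forall>u\<in>sphere (0::real^'n) 1. norm (A *v v) \<le> norm (A *v u)"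
    by (rule continuous_attains_inf)
       (auto intro!: continuous_on_norm matrix_vector_mult_linear_continuous_on)
  then obtain v0 where v0: "norm v0 = 1"
    and le: "\<And>u. norm u = 1 \<Longrightarrow> norm (A *v v0) \<le> norm (A *v u)" by auto
  define \<mu> where "\<mu> = (norm (A *v v0))\<^sup>2"
  have q: "\<mu> * (u \<bullet> u) \<le> (A *v u) \<bullet> (A *v u)" for u
  proof (cases "u = 0")
    case False
    have "norm (A *v v0) \<le> norm (A *v ((1 / norm u) *\<^sub>R u))" by (rule le) (simp add: False)
    also have "\<dots> = norm (A *v u) / norm u"
      by (simp add: matrix_vector_mult_scaleR)
    finally have "norm (A *v v0) * norm u \<le> norm (A *v u)"
      using False by (simp add: field_simps)
    then have "(norm (A *v v0) * norm u)\<^sup>2 \<le> (norm (A *v u))\<^sup>2" by (intro power_mono) auto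
    then show ?thesis by (simp add: \<mu>_def power_mult_distrib power2_norm_eq_inner)
  qed simp
  define z where "z = ?M *v v0 - \<mu> *\<^sub>R v0"
  define c where "c = z \<bullet> z"
  define Q where "Q = (A *v z) \<bullet> (A *v z) - \<mu> * (z \<bullet> z)"
  have Q0: "Q \<ge> 0" using q[of z] by (simp add: Q_def)
  have cz: "c = (A *v v0) \<bullet> (A *v z) - \<mu> * (v0 \<bullet> z)"
    unfolding c_def by (subst (1) z_def) (simp add: inner_diff_left gram_inner)
  have n1: "v0 \<bullet> v0 = 1" using v0 by (simp add: norm_eq_1)
  have n2: "(A *v v0) \<bullet> (A *v v0) = \<mu>" by (simp add: \<mu>_def power2_norm_eq_inner)
  have quad: "0 \<le> 2 * t * c + t\<^sup>2 * Q" for t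
  proof -
    have "0 \<le> (A *v (v0 + t *\<^sub>R z)) \<bullet> (A *v (v0 + t *\<^sub>R z)) - \<mu> * ((v0 + t *\<^sub>R z) \<bullet> (v0 + t *\<^sub>R z))"
      using q[of "v0 + t *\<^sub>R z"] by simp
    also have "\<dots> = 2 * t * c + t\<^sup>2 * Q"
      by (simp add: cz Q_def matrix_vector_right_distrib matrix_vector_mult_scaleR inner_add_left inner_add_right
          n1 n2 inner_commute[of z v0] inner_commute[of "A *v z" "A *v v0"] power2_eq_square algebra_simps)
    finally show ?thesis .
  qed
  define D where "D = Q + 1"
  have D: "D > 0" using Q0 by (simp add: D_def)
  have "0 \<le> D\<^sup>2 * (2 * (- c / D) * c + (- c / D)\<^sup>2 * Q)"
    using quad[of "- c / D"] by (intro mult_nonneg_nonneg) auto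
  also have "\<dots> = c\<^sup>2 * (Q - 2 * D)"
    using D by (simp add: field_simps power2_eq_square)
  finally have "c\<^sup>2 * (Q + 2) \<le> 0" by (simp add: D_def algebra_simps)
  then have "c = 0" using Q0 by (simp add: mult_le_0_iff)
  then have "?M *v v0 = \<mu> *\<^sub>R v0" by (simp add: c_def z_def)
  moreover have "v0 \<noteq> 0" using v0 by auto
  ultimately have "sqrt \<mu> \<in> singular_values A" unfolding singular_values_def by blast
  then have mem: "norm (A *v v0) \<in> singular_values A" by (simp add: \<mu>_def)
  have "norm (A *v v0) \<le> s" if s: "s \<in> singular_values A" for s
  proof -
    obtain \<nu> v where v: "s = sqrt \<nu>" "v \<noteq> 0" "?M *v v = \<nu> *\<^sub>R v"
      using s unfolding singular_values_def by blast
    have "\<nu> * (v \<bullet> v) = (A *v v) \<bullet> (A *v v)" using v(3) gram_inner[of A v v] by simp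
    with q[of v] have "\<mu> * (v \<bullet> v) \<le> \<nu> * (v \<bullet> v)" by simp
    then have "\<mu> \<le> \<nu>" using v(2) by simp
    then show ?thesis unfolding v(1) \<mu>_def using real_le_rsqrt by blast
  qed
  then have eq: "sigma_min A = norm (A *v v0)"
    unfolding sigma_min_def using mem by (intro Min_eqI finite_singular_values) auto
  then show "\<exists>v. norm v = 1 \<and> sigma_min A = norm (A *v v)" using v0 by blast
  show "norm v = 1 \<Longrightarrow> sigma_min A \<le> norm (A *v v)" using eq le by simp
qed

end

theory Submission
  imports Defs
begin

text \<open>
  On the hyperplane \<open>e\<^sup>Tb = 1\<close> the matrix \<open>R\<^sub>k\<close> acts as the affine map
  \<open>b \<mapsto> h(a\<^sub>k) + J\<^sub>k (b - a\<^sub>k)\<close>, the linearization of \<open>h\<close> at \<open>a\<^sub>k\<close>. Since \<open>\<parallel>e\<parallel> = \<surd>n\<close>,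
  Cauchy-Schwarz gives \<open>1 \<le> \<surd>n \<parallel>b\<parallel>\<close>, so \<open>\<sigma>\<^sub>m\<^sub>i\<^sub>n(R\<^sub>k) \<le> \<surd>n \<parallel>R\<^sub>k b\<parallel>\<close>; take \<open>b = a\<^sub>k\<^sub>+\<^sub>1\<close>.
\<close>

lemma norm_one_vec: "norm (1 :: real^'n) = sqrt (real CARD('n))"
  by (simp add: norm_vec_def L2_set_def)

lemma norm_matrix_vector_mul_le_opnorm:
  fixes A :: "real^'n^'m"
  shows "norm (A *v v) \<le> opnorm A * norm v"
  unfolding opnorm_def by (rule onorm) (rule matrix_vector_mul_bounded_linear)

text \<open>Homogeneity: a nonzero \<open>v\<close> is rescaled to the unit sphere, where the
  variational bound applies.\<close>

lemma sigma_min_mult_norm_le: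
  fixes A :: "real^'n^'m"
  shows "sigma_min A * norm v \<le> norm (A *v v)"
proof (cases "v = 0")
  case False
  have "sigma_min A \<le> norm (A *v ((1 / norm v) *\<^sub>R v))"
    by (rule sigma_min_variational(2)) (simp add: False)
  then show ?thesis
    using False by (simp add: matrix_vector_mult_scaleR field_simps)
qed simp

text \<open>The minimum is attained, hence is itself a norm. This sign is what permits multiplying
  \<open>1 \<le> sqrt n * norm b\<close> by \<open>sigma_min A\<close>.\<close>

lemma sigma_min_nonneg:
  fixes A :: "real^'n^'m"
  shows "0 \<le> sigma_min A"
  using sigma_min_variational(1)[of A] by auto

lemma sigma_min_le_of_sum_eq_one:
  fixes A :: "real^'n^'m"
  assumes "1 \<bullet> b = 1"
  shows "sigma_min A \<le> sqrt (real CARD('n)) * norm (A *v b)"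
proof -
  have "1 \<le> sqrt (real CARD('n)) * norm b"
    using norm_cauchy_schwarz[of 1 b] assms by (simp add: norm_one_vec)
  then have "sigma_min A \<le> sigma_min A * (sqrt (real CARD('n)) * norm b)"
    using mult_left_mono[OF _ sigma_min_nonneg[of A]] by fastforce
  also have "\<dots> = sqrt (real CARD('n)) * (sigma_min A * norm b)"
    by simp
  also have "\<dots> \<le> sqrt (real CARD('n)) * norm (A *v b)"
    by (intro mult_left_mono sigma_min_mult_norm_le) simp
  finally show ?thesis .
qed

text \<open>Associativity for a rank-one matrix: in \<open>u (v^T b)\<close> the inner factor is a
  scalar.\<close>

lemma columnvector_rowvector_mult:
  fixes u :: "real^'m" and v b :: "real^'n"
  shows "((columnvector u :: real^1^'m) ** (rowvector v :: real^'n^1)) *v b = (v \<bullet> b) *\<^sub>R u"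
  by (simp add: vec_eq_iff matrix_matrix_mult_def matrix_vector_mult_def columnvector_def
      rowvector_def inner_vec_def sum_distrib_left mult_ac)

text \<open>The constraint turns the rank-one term into the constant \<open>h(a) - J a\<close>, and
  \<open>J b - J a\<close> collapses to \<open>J (b - a)\<close>.\<close>

lemma R_mat_mult_of_sum_eq_one:
  assumes "1 \<bullet> b = 1"
  shows "R_mat f x \<sigma> \<tau> w s a *v b = Jac f x \<sigma> \<tau> w s a *v (b - a) + h_res f x \<sigma> \<tau> w s a"
  by (simp add: R_mat_def matrix_vector_mult_add_rdistrib columnvector_rowvector_mult assms
      matrix_vector_mult_diff_distrib)

theorem theorem4p6:
  fixes S :: "(real^'d) set" and T :: real and x0 :: "real^'p"
    and f :: "real^'p \<Rightarrow> real \<Rightarrow> real^'d \<Rightarrow> real^'p"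
    and x :: "real \<Rightarrow> real^'d \<Rightarrow> real^'p"
    and \<tau> :: "'m::{finite,linorder} \<Rightarrow> real" and w :: "'m \<Rightarrow> real"
    and \<sigma> :: "'n::finite \<Rightarrow> real^'d" and s :: "real^'d"
    and a a' :: "real^'n"
  assumes "T > 0"
    and "\<exists>L. \<forall>t\<in>{0..T}. \<forall>r\<in>S. L-lipschitz_on UNIV (\<lambda>y. f y t r)"
    and "\<forall>t\<in>{0..T}. \<forall>r\<in>S. \<forall>y. (\<lambda>z. f z t r) differentiable (at y)"
    and "\<forall>t\<in>{0..T}. \<forall>r\<in>S. \<forall>y. invertible (jacobian (\<lambda>z. f z t r) (at y))"
    and "\<forall>r\<in>S. x 0 r = x0"
    and "\<forall>r\<in>S. \<forall>t\<in>{0..T}.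
           ((\<lambda>u. x u r) has_vector_derivative f (x t r) t r) (at t within {0..T})"
    and "bounded {x t r | t r. t \<in> {0..T} \<and> r \<in> S}"
    and "strict_mono \<tau>" and "\<forall>i. 0 \<le> \<tau> i \<and> \<tau> i \<le> T"
    and "\<forall>i. w i > 0"
    and "CARD('n) \<le> CARD('m) * CARD('p)"
    and "\<forall>j. \<sigma> j \<in> S" and "s \<in> S"
    and "1 \<bullet> a = 1"
    and "is_arg_min (\<lambda>b. norm (R_mat f x \<sigma> \<tau> w s a *v b)) (\<lambda>b. 1 \<bullet> b = 1) a'"
  shows "sigma_min (R_mat f x \<sigma> \<tau> w s a) \<le>
           sqrt (real CARD('n)) *
           (opnorm (Jac f x \<sigma> \<tau> w s a) * norm (a' - a) + sqrt (rho f x \<sigma> \<tau> w s a))"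
proof -
  let ?J = "Jac f x \<sigma> \<tau> w s a" and ?R = "R_mat f x \<sigma> \<tau> w s a"
    and ?h = "h_res f x \<sigma> \<tau> w s a"
  \<comment> \<open>Feasibility of the minimizer puts \<open>a'\<close> on the hyperplane, where the
    two preceding estimates hold.\<close>
  have a': "1 \<bullet> a' = 1"
    using assms(15) by (simp add: is_arg_min_def)
  have "norm (?R *v a') \<le> norm (?J *v (a' - a)) + norm ?h"
    unfolding R_mat_mult_of_sum_eq_one[OF a'] by (rule norm_triangle_ineq)
  \<comment> \<open>\<open>rho\<close> is the squared norm of \<open>h\<close>, so its root is
    exactly the second summand.\<close>
  also have "\<dots> \<le> opnorm ?J * norm (a' - a) + sqrt (rho f x \<sigma> \<tau> w s a)"
    by (simp add: rho_def norm_matrix_vector_mul_le_opnorm)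
  finally show ?thesis
    by (intro order_trans[OF sigma_min_le_of_sum_eq_one[OF a']] mult_left_mono) simp_all
qed

end
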